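(* Let $(X,\rho,\mu)$ be a space of homogeneous type and let $f:X\to X$ be an $\eta$-quasisymmetric map from $X$ onto itself. Choose $\theta$ and $k$ such that $$0\le\eta(\theta)\le\frac13\quad\text{and}\quad k\ge\frac1\theta.$$ For each ball $B(x,r)$ in $X$, let $$s:=\sup_{x'\in f(B(x,r))}\rho(f(x),x')\quad\text{and}\quad t:=\inf_{x'\in X\setminus f(B(x,kr))}\rho(f(x),x').$$ Then $s<t$, and hence $B(f(x),s)\subset B(f(x),t)$.
   Context: A quasimetric on a set $X$ is a function $\rho:X\times X\to[0,\infty)$ with $\rho(x,y)=0$ iff $x=y$, $\rho(x,y)=\rho(y,x)$, and $\rho(x,z)\le A_0\rho(x,y)+A_0\rho(y,z)$ for all $x,y,z$, with $A_0\ge1$ a constant. $B(x,r)=\{y:\rho(x,y)<r\}$ (quasiball); a set $O$ is open if each $x\in O$ has a quasiball $B(x,r)\subset O$. A measure $\mu$ is doubling if quasiballs are $\mu$-measurable and there is $A_1\ge1$ with $0<\mu(B(x,2r))\le A_1\mu(B(x,r))<\infty$ for all $x\in X$, $r>0$. A space of homogeneous type is a triple $(X,\rho,\mu)$ with $X$ nonempty, $\rho$ a quasimetric, $\mu$ doubling. A homeomorphism $f:(X,\rho)\to(X,\rho)$ is $\eta$-quasisymmetric if $\eta:[0,\infty)\to[0,\infty)$ is an increasing homeomorphism and for all $\theta\ge0$ and all distinct $x,a,b\in X$, $\frac{\rho(x,a)}{\rho(x,b)}\le\theta$ implies $\frac{\rho(f(x),f(a))}{\rho(f(x),f(b))}\le\eta(\theta)$.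 The condition $k\ge 1/\theta$ presupposes $\theta>0$. The infimum over the empty set is $+\infty$.
   Formalization: The condition k ≥ 1 is added: with quasisymmetry required only for distinct x, a, b, the claim fails for k < 1 (e.g. a two-point space with f the identity, η(u) = u/10, θ = 3, k = 1/3, r = 2 gives s = t = 1). *)

theory Defs
  imports "HOL-Analysis.Analysis"
begin

definition quasimetric_on :: "'a set \<Rightarrow> ('a \<Rightarrow> 'a \<Rightarrow> real) \<Rightarrow> bool" where
  "quasimetric_on X \<rho> \<longleftrightarrow>
     (\<forall>x\<in>X. \<forall>y\<in>X. 0 \<le> \<rho> x y) \<and>
     (\<forall>x\<in>X. \<forall>y\<in>X. \<rho> x y = 0 \<longleftrightarrow> x = y) \<and>
     (\<forall>x\<in>X. \<forall>y\<in>X. \<rho> x y = \<rho> y x) \<and>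
     (\<exists>A0\<ge>1. \<forall>x\<in>X. \<forall>y\<in>X. \<forall>z\<in>X. \<rho> x z \<le> A0 * \<rho> x y + A0 * \<rho> y z)"

text \<open>The radius is an extended real, since balls of radius \<open>\<infinity>\<close> (the whole space) also occur.\<close>

definition quasiball :: "'a set \<Rightarrow> ('a \<Rightarrow> 'a \<Rightarrow> real) \<Rightarrow> 'a \<Rightarrow> ereal \<Rightarrow> 'a set" where
  "quasiball X \<rho> x r = {y \<in> X. ereal (\<rho> x y) < r}"

text \<open>Quasiballs themselves need not be open in this topology.\<close>

definition quasimetric_topology :: "'a set \<Rightarrow> ('a \<Rightarrow> 'a \<Rightarrow> real) \<Rightarrow> 'a topology" where
  "quasimetric_topology X \<rho> =
     topology (\<lambda>U. U \<subseteq> X \<and> (\<forall>x\<in>U. \<exists>r>0. quasiball X \<rho> x (ereal r) \<subseteq> U))"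

lemma quasiball_mono: "r \<le> r' \<Longrightarrow> quasiball X \<rho> x r \<subseteq> quasiball X \<rho> x r'"
  by (auto simp: quasiball_def)

lemma openin_quasimetric_topology:
  "openin (quasimetric_topology X \<rho>) U \<longleftrightarrow>
     U \<subseteq> X \<and> (\<forall>x\<in>U. \<exists>r>0. quasiball X \<rho> x (ereal r) \<subseteq> U)"
proof -
  have "istopology (\<lambda>U. U \<subseteq> X \<and> (\<forall>x\<in>U. \<exists>r>0. quasiball X \<rho> x (ereal r) \<subseteq> U))"
    unfolding istopology_def
  proof (intro conjI allI impI ballI)
    fix S T x
    assume S: "S \<subseteq> X \<and> (\<forall>x\<in>S. \<exists>r>0. quasiball X \<rho> x (ereal r) \<subseteq> S)"
      and T: "T \<subseteq> X \<and> (\<forall>x\<in>T. \<exists>r>0. quasiball X \<rho> x (ereal r) \<subseteq> T)"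
    show "S \<inter> T \<subseteq> X" using S by blast
    assume "x \<in> S \<inter> T"
    then obtain r q where r: "r > 0" "quasiball X \<rho> x (ereal r) \<subseteq> S"
      and q: "q > 0" "quasiball X \<rho> x (ereal q) \<subseteq> T"
      using S T by blast
    have "quasiball X \<rho> x (ereal (min r q)) \<subseteq> S \<inter> T"
      using r q quasiball_mono[of "ereal (min r q)" "ereal r" X \<rho> x]
        quasiball_mono[of "ereal (min r q)" "ereal q" X \<rho> x] by auto
    then show "\<exists>r>0. quasiball X \<rho> x (ereal r) \<subseteq> S \<inter> T"
      using r q by (intro exI[of _ "min r q"]) auto
  next
    fix \<K> x
    assume K: "\<forall>K\<in>\<K>. K \<subseteq> X \<and> (\<forall>x\<in>K. \<exists>r>0. quasiball X \<rho> x (ereal r) \<subseteq> K)"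
    show "\<Union>\<K> \<subseteq> X" using K by blast
    assume "x \<in> \<Union>\<K>"
    then show "\<exists>r>0. quasiball X \<rho> x (ereal r) \<subseteq> \<Union>\<K>"
      using K by (meson Union_iff Union_upper order_trans)
  qed
  then show ?thesis
    by (simp add: quasimetric_topology_def topology_inverse')
qed

lemma topspace_quasimetric_topology [simp]: "topspace (quasimetric_topology X \<rho>) = X"
proof
  show "topspace (quasimetric_topology X \<rho>) \<subseteq> X"
    using openin_topspace[of "quasimetric_topology X \<rho>"]
    unfolding openin_quasimetric_topology by blast
  have "quasiball X \<rho> x (ereal 1) \<subseteq> X" for x
    by (auto simp: quasiball_def)
  then have "openin (quasimetric_topology X \<rho>) X"
    unfolding openin_quasimetric_topology by (auto intro!: exI[of _ "1::real"])
  then show "X \<subseteq> topspace (quasimetric_topology X \<rho>)"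
    by (rule openin_subset)
qed

definition doubling_measure :: "'a set \<Rightarrow> ('a \<Rightarrow> 'a \<Rightarrow> real) \<Rightarrow> 'a measure \<Rightarrow> bool" where
  "doubling_measure X \<rho> \<mu> \<longleftrightarrow>
     space \<mu> = X \<and>
     (\<forall>x\<in>X. \<forall>r>0. quasiball X \<rho> x (ereal r) \<in> sets \<mu>) \<and>
     (\<exists>A1\<ge>1. \<forall>x\<in>X. \<forall>r>0.
        0 < emeasure \<mu> (quasiball X \<rho> x (ereal (2 * r))) \<and>
        emeasure \<mu> (quasiball X \<rho> x (ereal (2 * r)))
          \<le> ennreal A1 * emeasure \<mu> (quasiball X \<rho> x (ereal r)) \<and>
        ennreal A1 * emeasure \<mu> (quasiball X \<rho> x (ereal r)) < \<infinity>)"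

definition homogeneous_type_space :: "'a set \<Rightarrow> ('a \<Rightarrow> 'a \<Rightarrow> real) \<Rightarrow> 'a measure \<Rightarrow> bool" where
  "homogeneous_type_space X \<rho> \<mu> \<longleftrightarrow>
     X \<noteq> {} \<and> quasimetric_on X \<rho> \<and> doubling_measure X \<rho> \<mu>"

definition increasing_homeomorphism :: "(real \<Rightarrow> real) \<Rightarrow> bool" where
  "increasing_homeomorphism \<eta> \<longleftrightarrow>
     strict_mono_on {0..} \<eta> \<and> homeomorphic_map (top_of_set {0..}) (top_of_set {0..}) \<eta>"

definition quasisymmetric ::
    "'a set \<Rightarrow> ('a \<Rightarrow> 'a \<Rightarrow> real) \<Rightarrow> (real \<Rightarrow> real) \<Rightarrow> ('a \<Rightarrow> 'a) \<Rightarrow> bool" where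
  "quasisymmetric X \<rho> \<eta> f \<longleftrightarrow>
     homeomorphic_map (quasimetric_topology X \<rho>) (quasimetric_topology X \<rho>) f \<and>
     increasing_homeomorphism \<eta> \<and>
     (\<forall>\<theta>\<ge>0. \<forall>x\<in>X. \<forall>a\<in>X. \<forall>b\<in>X. x \<noteq> a \<longrightarrow> x \<noteq> b \<longrightarrow> a \<noteq> b \<longrightarrow>
        \<rho> x a / \<rho> x b \<le> \<theta> \<longrightarrow> \<rho> (f x) (f a) / \<rho> (f x) (f b) \<le> \<eta> \<theta>)"

end

theory Submission
  imports Defs
begin

text \<open>
  If \<open>a\<close> lies in \<open>B(x,r)\<close> and \<open>b\<close> lies outside \<open>B(x,kr)\<close>, then
  \<open>\<rho>(x,a)/\<rho>(x,b) < 1/k \<le> \<theta>\<close>, so quasisymmetry bounds \<open>\<rho>(f x, f a)\<close> by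
  \<open>\<eta>(\<theta>) \<le> 1/3\<close> times \<open>\<rho>(f x, f b)\<close> (\<open>quasisymmetric_separates_balls\<close>).  As \<open>f\<close> is onto, passing to the
  supremum over \<open>a\<close> and the infimum over \<open>b\<close> gives \<open>3s \<le> t\<close>, hence \<open>s < t\<close>
  whenever \<open>0 < s < \<infinity>\<close>.

  There remain the two extreme values of \<open>s\<close>.  The infimum \<open>t\<close> is infinite when nothing lies
  outside \<open>f(B(x,kr))\<close>; then \<open>X = B(x,kr)\<close> is bounded, so \<open>s\<close> is still finite
  (\<open>quasimetric_bounded_recentre\<close>).  And \<open>s = 0\<close> forces \<open>B(x,r) = {x}\<close> by injectivity; then
  \<open>x\<close> is an isolated point, and since \<open>f\<close> is a homeomorphism so is \<open>f x\<close>, which keeps \<open>t\<close>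
  away from \<open>0\<close> (\<open>homeomorphism_isolated_point\<close>).
\<close>

lemma quasimetric_on_nonneg:
  assumes "quasimetric_on X \<rho>" "x \<in> X" "y \<in> X"
  shows "0 \<le> \<rho> x y"
proof -
  have "\<forall>x\<in>X. \<forall>y\<in>X. 0 \<le> \<rho> x y"
    using assms(1) unfolding quasimetric_on_def by (elim conjE)
  then show ?thesis
    using assms(2,3) by blast
qed

lemma quasimetric_on_eq_0_iff:
  assumes "quasimetric_on X \<rho>" "x \<in> X" "y \<in> X"
  shows "\<rho> x y = 0 \<longleftrightarrow> x = y"
proof -
  have "\<forall>x\<in>X. \<forall>y\<in>X. \<rho> x y = 0 \<longleftrightarrow> x = y"
    using assms(1) unfolding quasimetric_on_def by (elim conjE)
  then show ?thesis
    using assms(2,3) by blast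
qed

lemma quasisymmetric_bij_betw:
  assumes "quasisymmetric X \<rho> \<eta> f"
  shows "bij_betw f X X"
proof -
  have hom: "homeomorphic_map (quasimetric_topology X \<rho>) (quasimetric_topology X \<rho>) f"
    using assms unfolding quasisymmetric_def by blast
  show ?thesis
    using homeomorphic_imp_surjective_map[OF hom] homeomorphic_imp_injective_map[OF hom]
    by (simp add: bij_betw_def)
qed

text \<open>
  The condition \<open>k \<ge> 1\<close> makes \<open>a\<close> and \<open>b\<close> distinct; positivity of \<open>\<rho>(f x, f b)\<close>, needed to
  clear the denominator, is injectivity of \<open>f\<close>.
\<close>

lemma quasisymmetric_separates_balls:
  assumes qm: "quasimetric_on X \<rho>" and qs: "quasisymmetric X \<rho> \<eta> f"
    and \<theta>: "\<theta> > 0" and k: "k \<ge> 1 / \<theta>" "k \<ge> 1" and r: "r > 0"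
    and x: "x \<in> X" and a: "a \<in> X" "\<rho> x a < r" and b: "b \<in> X" "k * r \<le> \<rho> x b"
    and \<eta>: "0 \<le> \<eta> \<theta>"
  shows "\<rho> (f x) (f a) \<le> \<eta> \<theta> * \<rho> (f x) (f b)"
proof -
  have bij: "bij_betw f X X"
    using qs by (rule quasisymmetric_bij_betw)
  have fX: "f y \<in> X" if "y \<in> X" for y
    using bij that by (auto simp: bij_betw_def)
  have "0 < k * r"
    using k(2) r by simp
  then have xb: "0 < \<rho> x b"
    using b(2) by linarith
  then have "x \<noteq> b"
    using quasimetric_on_eq_0_iff[OF qm x b(1)] by auto
  then have "f x \<noteq> f b"
    using bij x b(1) by (auto simp: bij_betw_def dest: inj_onD)
  then have pos: "0 < \<rho> (f x) (f b)"
    using quasimetric_on_nonneg[OF qm fX[OF x] fX[OF b(1)]]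
      quasimetric_on_eq_0_iff[OF qm fX[OF x] fX[OF b(1)]] by linarith
  show ?thesis
  proof (cases "x = a")
    case True
    then have "\<rho> (f x) (f a) = 0"
      using quasimetric_on_eq_0_iff[OF qm fX[OF x] fX[OF a(1)]] by simp
    then show ?thesis
      using \<eta> pos by simp
  next
    case False
    have "r \<le> k * r"
      using k(2) r by simp
    then have "a \<noteq> b"
      using a(2) b(2) by auto
    have "1 \<le> \<theta> * k"
      using k(1) \<theta> by (simp add: field_simps)
    then have "r \<le> \<theta> * k * r"
      using r by simp
    also have "\<dots> \<le> \<theta> * \<rho> x b"
      using b(2) \<theta> by (simp add: mult.assoc)
    finally have "\<rho> x a / \<rho> x b \<le> \<theta>"
      using a(2) xb by (simp add: divide_le_eq)
    moreover have "\<forall>\<theta>\<ge>0. \<forall>x\<in>X. \<forall>a\<in>X. \<forall>b\<in>X. x \<noteq> a \<longrightarrow> x \<noteq> b \<longrightarrow> a \<noteq> b \<longrightarrow>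
        \<rho> x a / \<rho> x b \<le> \<theta> \<longrightarrow> \<rho> (f x) (f a) / \<rho> (f x) (f b) \<le> \<eta> \<theta>"
      using qs unfolding quasisymmetric_def by (elim conjE)
    ultimately have "\<rho> (f x) (f a) / \<rho> (f x) (f b) \<le> \<eta> \<theta>"
      using less_imp_le[OF \<theta>] x a(1) b(1) False \<open>x \<noteq> b\<close> \<open>a \<noteq> b\<close> by blast
    then show ?thesis
      using pos by (simp add: divide_le_eq)
  qed
qed

lemma quasimetric_bounded_recentre:
  assumes qm: "quasimetric_on X \<rho>" and "x \<in> X" "y \<in> X"
    and bdd: "\<And>z. z \<in> X \<Longrightarrow> \<rho> x z \<le> R"
  shows "\<exists>M. \<forall>z\<in>X. \<rho> y z \<le> M"
proof -
  have "\<exists>A\<ge>1. \<forall>u\<in>X. \<forall>v\<in>X. \<forall>w\<in>X. \<rho> u w \<le> A * \<rho> u v + A * \<rho> v w"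
    using qm unfolding quasimetric_on_def by (elim conjE)
  then obtain A where A: "A \<ge> 1"
    "\<forall>u\<in>X. \<forall>v\<in>X. \<forall>w\<in>X. \<rho> u w \<le> A * \<rho> u v + A * \<rho> v w"
    by (elim exE conjE)
  have "\<rho> y z \<le> A * \<rho> y x + A * R" if "z \<in> X" for z
  proof -
    have "\<rho> y z \<le> A * \<rho> y x + A * \<rho> x z"
      using A(2) assms(2,3) that by blast
    moreover have "A * \<rho> x z \<le> A * R"
      using A(1) bdd[OF that] by simp
    ultimately show ?thesis
      by linarith
  qed
  then show ?thesis
    by blast
qed

text \<open>
  Quasiballs need not be open, but a quasiball that reduces to its centre is, directly from the
  definition of the topology; a homeomorphism carries the open singleton to an open singleton.
\<close>

lemma homeomorphism_isolated_point:
  assumes hom: "homeomorphic_map (quasimetric_topology X \<rho>) (quasimetric_topology Y \<sigma>) f"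
    and "x \<in> X" and "r > 0" and ball: "quasiball X \<rho> x (ereal r) \<subseteq> {x}"
  shows "\<exists>\<delta>>0. \<forall>y\<in>Y. y \<noteq> f x \<longrightarrow> \<delta> \<le> \<sigma> (f x) y"
proof -
  have "openin (quasimetric_topology X \<rho>) {x}"
    using assms by (auto simp: openin_quasimetric_topology)
  then have "openin (quasimetric_topology Y \<sigma>) (f ` {x})"
    using hom homeomorphic_imp_open_map open_map_def by blast
  then obtain \<delta> where "\<delta> > 0" "quasiball Y \<sigma> (f x) (ereal \<delta>) \<subseteq> {f x}"
    by (auto simp: openin_quasimetric_topology)
  then have "\<forall>y\<in>Y. y \<noteq> f x \<longrightarrow> \<delta> \<le> \<sigma> (f x) y"
    by (force simp: quasiball_def)
  then show ?thesis
    using \<open>\<delta> > 0\<close> by blast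
qed

theorem lemma4p6:
  fixes X :: "'a set" and \<rho> :: "'a \<Rightarrow> 'a \<Rightarrow> real" and \<mu> :: "'a measure"
    and f :: "'a \<Rightarrow> 'a" and \<eta> :: "real \<Rightarrow> real"
    and \<theta> k r :: real and x :: 'a and s t :: ereal
  assumes "homogeneous_type_space X \<rho> \<mu>"
    and "quasisymmetric X \<rho> \<eta> f"
    and "\<theta> > 0" and "0 \<le> \<eta> \<theta>" and "\<eta> \<theta> \<le> 1 / 3"
    and "k \<ge> 1 / \<theta>" and "k \<ge> 1"
    and "x \<in> X" and "r > 0"
    and "s = (SUP x'\<in>f ` quasiball X \<rho> x (ereal r). ereal (\<rho> (f x) x'))"
    and "t = (INF x'\<in>X - f ` quasiball X \<rho> x (ereal (k * r)). ereal (\<rho> (f x) x'))"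
  shows "s < t \<and> quasiball X \<rho> (f x) s \<subseteq> quasiball X \<rho> (f x) t"
proof -
  let ?B = "quasiball X \<rho> x (ereal r)" and ?kB = "quasiball X \<rho> x (ereal (k * r))"
  have qm: "quasimetric_on X \<rho>"
    using assms(1) by (simp add: homogeneous_type_space_def)
  have bij: "bij_betw f X X"
    using assms(2) by (rule quasisymmetric_bij_betw)
  have fX: "f y \<in> X" if "y \<in> X" for y
    using bij that by (auto simp: bij_betw_def)
  have inj: "f y = f z \<longleftrightarrow> y = z" if "y \<in> X" "z \<in> X" for y z
    using bij that by (auto simp: bij_betw_def dest: inj_onD)
  have nonneg: "0 \<le> \<rho> (f x) (f y)" if "y \<in> X" for y
    by (rule quasimetric_on_nonneg[OF qm fX[OF assms(8)] fX[OF that]])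
  have xB: "x \<in> ?B" and xkB: "x \<in> ?kB"
    using quasimetric_on_eq_0_iff[OF qm assms(8,8)] assms(7-9) by (simp_all add: quasiball_def)

  have third: "3 * \<rho> (f x) (f a) \<le> \<rho> (f x) y" if a: "a \<in> ?B" and y: "y \<in> X - f ` ?kB" for a y
  proof -
    obtain b where b: "b \<in> X" "y = f b"
      using y bij by (auto simp: bij_betw_def)
    have "k * r \<le> \<rho> x b"
      using y b by (force simp: quasiball_def)
    then have "\<rho> (f x) (f a) \<le> \<eta> \<theta> * \<rho> (f x) y"
      using quasisymmetric_separates_balls[OF qm assms(2,3,6,7,9,8) _ _ b(1) _ assms(4)]
        a b(2) by (simp add: quasiball_def)
    also have "\<dots> \<le> 1 / 3 * \<rho> (f x) y"
      using assms(5) nonneg[OF b(1)] b(2) by (intro mult_right_mono) auto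
    finally show ?thesis
      by simp
  qed

  have upper: "ereal (\<rho> (f x) (f a)) \<le> s" if "a \<in> ?B" for a
    unfolding assms(10) using that by (intro SUP_upper) auto
  have s_le: "s \<le> ereal (\<rho> (f x) y / 3)" if "y \<in> X - f ` ?kB" for y
    unfolding assms(10) using third[OF _ that] by (intro SUP_least) force
  have "0 \<le> s"
    using upper[OF xB] nonneg[OF assms(8)] by (simp add: order_trans[rotated])
  moreover have "\<exists>M. s \<le> ereal M"
  proof (cases "X - f ` ?kB = {}")
    case True
    \<comment> \<open>Here \<open>f\<close> maps the ball of radius \<open>k r\<close> onto \<open>X\<close>, so that ball is \<open>X\<close> itself.\<close>
    have "\<rho> x z \<le> k * r" if "z \<in> X" for z
    proof -
      obtain w where w: "w \<in> ?kB" "f z = f w"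
        using True fX[OF \<open>z \<in> X\<close>] by blast
      then have "z = w"
        using inj[of z w] that by (simp add: quasiball_def)
      then show ?thesis
        using w(1) by (simp add: quasiball_def)
    qed
    then obtain M where M: "\<forall>z\<in>X. \<rho> (f x) z \<le> M"
      using quasimetric_bounded_recentre[OF qm assms(8) fX[OF assms(8)]] by blast
    then have "s \<le> ereal M"
      unfolding assms(10) using fX by (intro SUP_least) (auto simp: quasiball_def)
    then show ?thesis ..
  next
    case False
    then obtain y where y: "y \<in> X - f ` ?kB"
      by blast
    show ?thesis
      using s_le[OF y] ..
  qed
  ultimately obtain S where S: "s = ereal S" "0 \<le> S"
    by (cases s) auto

  have "s < t"
  proof (cases "S = 0")
    case False
    have "3 * S \<le> \<rho> (f x) y" if "y \<in> X - f ` ?kB" for y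
      using s_le[OF that] S(1) by simp
    then have "ereal (3 * S) \<le> t"
      unfolding assms(11) by (intro INF_greatest) auto
    moreover have "s < ereal (3 * S)"
      using S False by simp
    ultimately show ?thesis
      by (rule less_le_trans[rotated])
  next
    case True
    have "a = x" if "a \<in> ?B" for a
    proof -
      have a: "a \<in> X"
        using that by (simp add: quasiball_def)
      have "\<rho> (f x) (f a) = 0"
        using upper[OF that] S(1) True nonneg[OF a] by simp
      then show ?thesis
        using quasimetric_on_eq_0_iff[OF qm fX[OF assms(8)] fX[OF a]] inj[OF a assms(8)] by auto
    qed
    then have "?B \<subseteq> {x}"
      by blast
    moreover have "homeomorphic_map (quasimetric_topology X \<rho>) (quasimetric_topology X \<rho>) f"
      using assms(2) unfolding quasisymmetric_def by (elim conjE)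
    ultimately obtain \<delta> where \<delta>: "\<delta> > 0" "\<forall>y\<in>X. y \<noteq> f x \<longrightarrow> \<delta> \<le> \<rho> (f x) y"
      using homeomorphism_isolated_point assms(8,9) by metis
    then have "ereal \<delta> \<le> t"
      unfolding assms(11) using xkB by (intro INF_greatest) auto
    moreover have "s < ereal \<delta>"
      using S(1) True \<delta>(1) by simp
    ultimately show ?thesis
      by (rule less_le_trans[rotated])
  qed
  then show ?thesis
    by (simp add: quasiball_mono less_imp_le)
qed

end
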